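(* Let $\mathcal{X}$ and $\mathcal{Y}$ be two finite non-empty sets. The topology induced by the BRM metric $d_{\mathcal{X},\mathcal{Y}}^{(s)}$ on $\mathrm{DMC}_{\mathcal{X},\mathcal{Y}}^{(s)}$ is the same as the quotient topology $\mathcal{T}_{\mathcal{X},\mathcal{Y}}^{(s)}$. Moreover, $(\mathrm{DMC}_{\mathcal{X},\mathcal{Y}}^{(s)},d_{\mathcal{X},\mathcal{Y}}^{(s)})$ is compact and path-connected.
   Context: For finite sets $\mathcal{A},\mathcal{B}$, $\mathrm{DMC}_{\mathcal{A},\mathcal{B}}$ is the set of channels from $\mathcal{A}$ to $\mathcal{B}$, i.e. families $W=(W(b|a))_{a\in\mathcal{A},b\in\mathcal{B}}$ of non-negative reals with $\sum_{b}W(b|a)=1$ for every $a$, endowed with the metric $d_{\mathcal{A},\mathcal{B}}(W,W')=\frac12\max_{a}\sum_{b}|W'(b|a)-W(b|a)|$ and its topology $\mathcal{T}_{\mathcal{A},\mathcal{B}}$. $\Delta_{\mathcal{A}}$ is the set of probability distributions on $\mathcal{A}$; $[n]=\{1,\dots,n\}$; $(V\circ W)(c|a)=\sum_{b}V(c|b)W(b|a)$. $W'\in\mathrm{DMC}_{\mathcal{X}',\mathcal{Y}'}$ contains $W\in\mathrm{DMC}_{\mathcal{X},\mathcal{Y}}$ if there exist $n\geq 1$, $\alpha\in\Delta_{[n]}$, $R_i\in\mathrm{DMC}_{\mathcal{X},\mathcal{X}'}$, $T_i\in\mathrm{DMC}_{\mathcal{Y}',\mathcal{Y}}$ such that $W=\sum_{i=1}^n\alpha(i)\,T_i\circ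 W'\circ R_i$. $W$ and $W'$ are Shannon-equivalent if each contains the other. $\mathrm{DMC}_{\mathcal{X},\mathcal{Y}}^{(s)}$ is the quotient of $\mathrm{DMC}_{\mathcal{X},\mathcal{Y}}$ by Shannon-equivalence, and $\mathcal{T}_{\mathcal{X},\mathcal{Y}}^{(s)}$ is the quotient of the topology $\mathcal{T}_{\mathcal{X},\mathcal{Y}}$. For $n,m\ge1$, $l\in\Delta_{[n]\times[m]}$ and $W\in\mathrm{DMC}_{\mathcal{X},\mathcal{Y}}$, let $$\$_{\mathrm{opt}}(l,W)=\sup \frac1n\sum_{u\in[n]}\sum_{i=1}^{k}\alpha(i)\sum_{y\in\mathcal{Y}}W(y|f_i(u))\,l(u,g_i(y)),$$ the supremum being over all $k\ge1$, $\alpha\in\Delta_{[k]}$, functions $f_1,\dots,f_k:[n]\to\mathcal{X}$ and $g_1,\dots,g_k:\mathcal{Y}\to[m]$. This depends only on the Shannon-equivalence class $\hat W$ of $W$, so one writes $\$_{\mathrm{opt}}(l,\hat W)$. The BRM metric on $\mathrm{DMC}_{\mathcal{X},\mathcal{Y}}^{(s)}$ is $$d_{\mathcal{X},\mathcal{Y}}^{(s)}(\hat W_1,\hat W_2)=\sup_{n,m\ge1,\ l\in\Delta_{[n]\times[m]}}|\$_{\mathrm{opt}}(l,\hat W_1)-\$_{\mathrm{opt}}(l,\hat W_2)|.$$ *)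

theory Defs
  imports "HOL-Analysis.Analysis"
begin

section \<open>Channels between finite sets\<close>

text \<open>Distributions and channels on carrier sets are total functions that vanish off the carrier.
  This makes them determined by their values on the carrier, and the convention is preserved
  by composition and by mixtures.\<close>

definition distributions :: "'a set \<Rightarrow> ('a \<Rightarrow> real) set" where
  "distributions A = {p. (\<forall>a\<in>A. 0 \<le> p a) \<and> (\<forall>a. a \<notin> A \<longrightarrow> p a = 0) \<and> (\<Sum>a\<in>A. p a) = 1}"

text \<open>The number \<open>W a b\<close> is the transition probability usually written $W(b|a)$.\<close>

definition DMC :: "'a set \<Rightarrow> 'b set \<Rightarrow> ('a \<Rightarrow> 'b \<Rightarrow> real) set" where
  "DMC A B = {W. (\<forall>a\<in>A. \<forall>b\<in>B. 0 \<le> W a b) \<and> (\<forall>a\<in>A. (\<Sum>b\<in>B. W a b) = 1) \<and>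
                 (\<forall>a b. a \<notin> A \<or> b \<notin> B \<longrightarrow> W a b = 0)}"

definition DMC_dist :: "'a set \<Rightarrow> 'b set \<Rightarrow> ('a \<Rightarrow> 'b \<Rightarrow> real) \<Rightarrow> ('a \<Rightarrow> 'b \<Rightarrow> real) \<Rightarrow> real" where
  "DMC_dist A B W W' = 1 / 2 * Max ((\<lambda>a. \<Sum>b\<in>B. \<bar>W' a b - W a b\<bar>) ` A)"

definition DMC_topology :: "'a set \<Rightarrow> 'b set \<Rightarrow> ('a \<Rightarrow> 'b \<Rightarrow> real) topology" where
  "DMC_topology A B = Metric_space.mtopology (DMC A B) (DMC_dist A B)"

text \<open>\<open>channel_comp B V W\<close> is $V \circ W$, where \<open>B\<close> is the output set of \<open>W\<close> and the
  input set of \<open>V\<close>.\<close>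

definition channel_comp ::
    "'b set \<Rightarrow> ('b \<Rightarrow> 'c \<Rightarrow> real) \<Rightarrow> ('a \<Rightarrow> 'b \<Rightarrow> real) \<Rightarrow> 'a \<Rightarrow> 'c \<Rightarrow> real" where
  "channel_comp B V W = (\<lambda>a c. \<Sum>b\<in>B. V b c * W a b)"

lemma Metric_space_DMC:
  assumes "finite A" "A \<noteq> {}" "finite B"
  shows "Metric_space (DMC A B) (DMC_dist A B)"
proof
  define S where "S = (\<lambda>W W' (a::'a). \<Sum>b\<in>B. \<bar>W' a b - W a b :: real\<bar>)"
  have d: "DMC_dist A B W W' = 1 / 2 * Max (S W W' ` A)" for W W'
    by (simp add: DMC_dist_def S_def)
  have S0: "0 \<le> S W W' a" for W W' a
    by (simp add: S_def sum_nonneg)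
  have le: "S W W' a \<le> Max (S W W' ` A)" if "a \<in> A" for W W' a
    using that assms by simp
  have ex: "\<exists>a\<in>A. Max (S W W' ` A) = S W W' a" for W W'
  proof -
    have "Max (S W W' ` A) \<in> S W W' ` A" using assms by (intro Max_in) simp_all
    then show ?thesis by blast
  qed
  show "0 \<le> DMC_dist A B W W'" for W W'
    using ex[of W W'] S0 by (auto simp: d)
  show "DMC_dist A B W W' = DMC_dist A B W' W" for W W'
    by (simp add: DMC_dist_def abs_minus_commute)
  show "DMC_dist A B W W' = 0 \<longleftrightarrow> W = W'" if "W \<in> DMC A B" "W' \<in> DMC A B" for W W'
  proof
    assume "DMC_dist A B W W' = 0"
    then have "S W W' a = 0" if "a \<in> A" for a
      using le[OF that, of W W'] S0[of W W' a] by (simp add: d)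
    then have "W a b = W' a b" if "a \<in> A" "b \<in> B" for a b
      using that assms by (auto simp: S_def sum_nonneg_eq_0_iff)
    moreover have "W a b = W' a b" if "a \<notin> A \<or> b \<notin> B" for a b
      using that \<open>W \<in> DMC A B\<close> \<open>W' \<in> DMC A B\<close> by (auto simp: DMC_def)
    ultimately show "W = W'" by (intro ext) blast
  next
    assume "W = W'"
    then show "DMC_dist A B W W' = 0"
      using ex[of W W'] by (auto simp: d) (simp add: S_def)
  qed
  show "DMC_dist A B U W \<le> DMC_dist A B U V + DMC_dist A B V W" for U V W
  proof -
    obtain a where a: "a \<in> A" "Max (S U W ` A) = S U W a" using ex by blast
    have "S U W a \<le> S U V a + S V W a"
      unfolding S_def sum.distrib[symmetric] by (intro sum_mono) linarith
    with le[OF a(1), of U V] le[OF a(1), of V W] a(2) show ?thesis by (simp add: d)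
  qed
qed

section \<open>Shannon containment and Shannon equivalence\<close>

definition shannon_contains ::
    "'c set \<Rightarrow> 'd set \<Rightarrow> ('c \<Rightarrow> 'd \<Rightarrow> real) \<Rightarrow> 'a set \<Rightarrow> 'b set \<Rightarrow> ('a \<Rightarrow> 'b \<Rightarrow> real) \<Rightarrow> bool" where
  "shannon_contains X' Y' W' X Y W \<longleftrightarrow>
     (\<exists>(n::nat) \<alpha> R T. n \<ge> 1 \<and> \<alpha> \<in> distributions {1..n} \<and>
        (\<forall>i\<in>{1..n}. R i \<in> DMC X X' \<and> T i \<in> DMC Y' Y) \<and>
        W = (\<lambda>x y. \<Sum>i=1..n. \<alpha> i * channel_comp Y' (T i) (channel_comp X' W' (R i)) x y))"

definition shannon_equiv ::
    "'a set \<Rightarrow> 'b set \<Rightarrow> (('a \<Rightarrow> 'b \<Rightarrow> real) \<times> ('a \<Rightarrow> 'b \<Rightarrow> real)) set" where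
  "shannon_equiv X Y = {(W, W'). W \<in> DMC X Y \<and> W' \<in> DMC X Y \<and>
     shannon_contains X Y W X Y W' \<and> shannon_contains X Y W' X Y W}"

definition DMC_s :: "'a set \<Rightarrow> 'b set \<Rightarrow> ('a \<Rightarrow> 'b \<Rightarrow> real) set set" where
  "DMC_s X Y = DMC X Y // shannon_equiv X Y"

definition shannon_class :: "'a set \<Rightarrow> 'b set \<Rightarrow> ('a \<Rightarrow> 'b \<Rightarrow> real) \<Rightarrow> ('a \<Rightarrow> 'b \<Rightarrow> real) set" where
  "shannon_class X Y W = shannon_equiv X Y `` {W}"

section \<open>The quotient topology\<close>

definition quotient_topology :: "'a topology \<Rightarrow> ('a \<Rightarrow> 'b) \<Rightarrow> 'b topology" where
  "quotient_topology T f =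
     topology (\<lambda>U. U \<subseteq> f ` topspace T \<and> openin T {x \<in> topspace T. f x \<in> U})"

lemma openin_quotient_topology:
  "openin (quotient_topology T f) U \<longleftrightarrow>
     U \<subseteq> f ` topspace T \<and> openin T {x \<in> topspace T. f x \<in> U}"
proof -
  have "istopology (\<lambda>U. U \<subseteq> f ` topspace T \<and> openin T {x \<in> topspace T. f x \<in> U})"
    unfolding istopology_def
  proof (intro conjI allI impI)
    fix U V
    assume U: "U \<subseteq> f ` topspace T \<and> openin T {x \<in> topspace T. f x \<in> U}"
      and V: "V \<subseteq> f ` topspace T \<and> openin T {x \<in> topspace T. f x \<in> V}"
    show "U \<inter> V \<subseteq> f ` topspace T" using U by blast
    have "{x \<in> topspace T. f x \<in> U \<inter> V} =
        {x \<in> topspace T. f x \<in> U} \<inter> {x \<in> topspace T. f x \<in> V}" by blast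
    with U V show "openin T {x \<in> topspace T. f x \<in> U \<inter> V}"
      by (simp only: openin_Int)
  next
    fix \<K>
    assume K: "\<forall>K\<in>\<K>. K \<subseteq> f ` topspace T \<and> openin T {x \<in> topspace T. f x \<in> K}"
    show "\<Union>\<K> \<subseteq> f ` topspace T" using K by blast
    have "{x \<in> topspace T. f x \<in> \<Union>\<K>} = (\<Union>K\<in>\<K>. {x \<in> topspace T. f x \<in> K})" by blast
    then show "openin T {x \<in> topspace T. f x \<in> \<Union>\<K>}" using K by auto
  qed
  then show ?thesis by (simp add: quotient_topology_def)
qed

lemma topspace_quotient_topology: "topspace (quotient_topology T f) = f ` topspace T"
proof -
  have "{x \<in> topspace T. f x \<in> f ` topspace T} = topspace T" by blast
  then have "openin (quotient_topology T f) (f ` topspace T)"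
    by (simp add: openin_quotient_topology)
  then show ?thesis
    using openin_subset[of "quotient_topology T f" "f ` topspace T"]
      openin_quotient_topology[of T f "topspace (quotient_topology T f)"] by blast
qed

lemma quotient_map_quotient_topology: "quotient_map T (quotient_topology T f) f"
  by (simp add: quotient_map_def topspace_quotient_topology openin_quotient_topology)

definition DMC_s_topology :: "'a set \<Rightarrow> 'b set \<Rightarrow> ('a \<Rightarrow> 'b \<Rightarrow> real) set topology" where
  "DMC_s_topology X Y = quotient_topology (DMC_topology X Y) (shannon_class X Y)"

lemma topspace_DMC_s_topology:
  assumes "finite X" "X \<noteq> {}" "finite Y"
  shows "topspace (DMC_s_topology X Y) = DMC_s X Y"
  using Metric_space.topspace_mtopology[OF Metric_space_DMC[OF assms]]
  by (auto simp: DMC_s_topology_def DMC_topology_def topspace_quotient_topology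
      DMC_s_def shannon_class_def quotient_def)

section \<open>Optimal average gain and the BRM metric\<close>

definition opt_gain ::
    "'a set \<Rightarrow> 'b set \<Rightarrow> nat \<Rightarrow> nat \<Rightarrow> (nat \<times> nat \<Rightarrow> real) \<Rightarrow> ('a \<Rightarrow> 'b \<Rightarrow> real) \<Rightarrow> real" where
  "opt_gain X Y n m l W =
     Sup {1 / real n * (\<Sum>u=1..n. \<Sum>i=1..k. \<alpha> i * (\<Sum>y\<in>Y. W (f i u) y * l (u, g i y))) |
          (k::nat) \<alpha> f g.
          k \<ge> 1 \<and> \<alpha> \<in> distributions {1..k} \<and>
          (\<forall>i\<in>{1..k}. f i \<in> {1..n} \<rightarrow> X \<and> g i \<in> Y \<rightarrow> {1..m})}"

text \<open>The common value of the optimal gain on all members of a Shannon class.\<close>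

definition opt_gain_s ::
    "'a set \<Rightarrow> 'b set \<Rightarrow> nat \<Rightarrow> nat \<Rightarrow> (nat \<times> nat \<Rightarrow> real) \<Rightarrow> ('a \<Rightarrow> 'b \<Rightarrow> real) set \<Rightarrow> real" where
  "opt_gain_s X Y n m l C = the_elem (opt_gain X Y n m l ` C)"

text \<open>The value \<open>0\<close> off \<open>DMC_s X Y\<close> is needed because the locale \<open>Metric_space\<close> requires
  nonnegativity also outside the carrier.\<close>

definition BRM_dist ::
    "'a set \<Rightarrow> 'b set \<Rightarrow> ('a \<Rightarrow> 'b \<Rightarrow> real) set \<Rightarrow> ('a \<Rightarrow> 'b \<Rightarrow> real) set \<Rightarrow> real" where
  "BRM_dist X Y C1 C2 =
     (if C1 \<in> DMC_s X Y \<and> C2 \<in> DMC_s X Y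
      then Sup {\<bar>opt_gain_s X Y n m l C1 - opt_gain_s X Y n m l C2\<bar> | n m l.
                n \<ge> 1 \<and> m \<ge> 1 \<and> l \<in> distributions ({1..n} \<times> {1..m})}
      else 0)"

end

theory Submission
  imports Defs
begin

text \<open>The optimal gain of a mixture of strategies is attained by a deterministic one, hence
  \<open>V\<close> contains \<open>W\<close> exactly if no payoff \<open>l\<close> gives \<open>W\<close> a larger optimal gain than \<open>V\<close>: if \<open>W\<close> is
  not a convex combination of the finitely many channels obtained from \<open>V\<close> by deterministic pre-
  and postprocessing, a separating hyperplane, shifted and rescaled to a distribution, is a payoff
  on which \<open>W\<close> does better. So \<open>BRM_dist\<close> separates the Shannon classes. Optimal gains are
  Lipschitz in the channel uniformly in \<open>l\<close>, so the class map from \<open>DMC_topology\<close> to the BRM topology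
  is a continuous surjection from a compact path-connected space onto a Hausdorff space, and such
  a map is a quotient map.\<close>

section \<open>Simplices and separation\<close>

text \<open>In the product topology on all functions this is a closed subset of a box with factors
  \<open>{0..1}\<close> on \<open>I\<close> and \<open>{0}\<close> off it, and the box is compact by
  Tychonoff. Vanishing off the carrier is what keeps the outer factors compact.\<close>

lemma compact_distributions:
  assumes "finite I"
  shows "compact (distributions I)"
proof -
  let ?B = "PiE UNIV (\<lambda>i. if i \<in> I then {0..1} else {0::real})"
  have "distributions I = ?B \<inter> {p. (\<Sum>i\<in>I. p i) = 1}"
  proof (intro equalityI subsetI)
    fix p assume p: "p \<in> distributions I"
    then have "p i \<le> 1" if "i \<in> I" for i
      using member_le_sum[of i I p] that assms by (auto simp: distributions_def)
    with p show "p \<in> ?B \<inter> {p. (\<Sum>i\<in>I. p i) = 1}" by (auto simp: distributions_def)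
  next
    fix p assume "p \<in> ?B \<inter> {p. (\<Sum>i\<in>I. p i) = 1}"
    then have p: "p i \<in> (if i \<in> I then {0..1} else {0})" and "(\<Sum>i\<in>I. p i) = 1" for i
      by (auto simp: PiE_def Pi_def)
    moreover have "0 \<le> p i" if "i \<in> I" for i using p[of i] that by simp
    moreover have "p i = 0" if "i \<notin> I" for i using p[of i] that by simp
    ultimately show "p \<in> distributions I" unfolding distributions_def by blast
  qed
  moreover have "compact ?B"
    by (subst compactin_euclidean_iff[symmetric], subst euclidean_product_topology[symmetric])
       (auto simp: compactin_PiE)
  moreover have "closed {p. (\<Sum>i\<in>I. p i :: real) = 1}"
    by (intro closed_Collect_eq continuous_intros continuous_on_product_coordinates)
  ultimately show ?thesis by (simp add: compact_Int_closed)
qed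

text \<open>The rows of a channel are chosen independently: a product of simplices over
  \<open>A\<close>, and of the zero row elsewhere, to which Tychonoff applies.\<close>

lemma compact_DMC:
  assumes "finite A" "finite B"
  shows "compact (DMC A B)"
proof -
  let ?C = "PiE UNIV (\<lambda>a. if a \<in> A then distributions B else {\<lambda>_. 0})"
  have "DMC A B = ?C"
    by (auto simp: DMC_def distributions_def PiE_def Pi_def split: if_splits; metis)
  moreover have "compact ?C"
    by (subst compactin_euclidean_iff[symmetric], subst euclidean_product_topology[symmetric])
       (auto simp: compactin_PiE compact_distributions[OF assms(2)])
  ultimately show ?thesis by simp
qed

text \<open>By compactness of the simplex of weights, the hull of the points \<open>p i\<close> has
  a point \<open>q \<alpha>\<close> nearest to \<open>w\<close>. Either the distance is zero, or the
  residual \<open>r\<close> from \<open>q \<alpha>\<close> to \<open>w\<close> is normal to a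
  separating hyperplane.\<close>

lemma convex_combination_or_separated:
  fixes p :: "'i \<Rightarrow> 'j \<Rightarrow> real" and w :: "'j \<Rightarrow> real"
  assumes "finite I" "I \<noteq> {}" "finite J"
  obtains (combination) \<alpha> where "\<alpha> \<in> distributions I" "\<And>j. j \<in> J \<Longrightarrow> w j = (\<Sum>i\<in>I. \<alpha> i * p i j)"
    | (separated) r c where "c < (\<Sum>j\<in>J. r j * w j)" "\<And>i. i \<in> I \<Longrightarrow> (\<Sum>j\<in>J. r j * p i j) \<le> c"
proof -
  define q where "q = (\<lambda>\<alpha> j. \<Sum>i\<in>I. \<alpha> i * p i j)"
  define h where "h = (\<lambda>\<alpha>. \<Sum>j\<in>J. (w j - q \<alpha> j)\<^sup>2)"
  obtain i0 where "i0 \<in> I" using assms by blast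
  then have "(\<lambda>i. of_bool (i = i0)) \<in> distributions I"
    using assms by (auto simp: distributions_def of_bool_def)
  then have "distributions I \<noteq> {}" by blast
  moreover have "continuous_on (distributions I) h"
    unfolding h_def q_def
    by (intro continuous_intros continuous_on_subset[OF continuous_on_product_coordinates] subset_UNIV)
  ultimately obtain \<alpha> where \<alpha>: "\<alpha> \<in> distributions I"
    and min: "\<And>\<beta>. \<beta> \<in> distributions I \<Longrightarrow> h \<alpha> \<le> h \<beta>"
    using continuous_attains_inf[OF compact_distributions[OF assms(1)]] by blast
  define r where "r = (\<lambda>j. w j - q \<alpha> j)"
  show thesis
  proof (cases "h \<alpha> = 0")
    case True
    then have "w j = q \<alpha> j" if "j \<in> J" for j
      using that assms by (auto simp: h_def sum_nonneg_eq_0_iff)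
    then show thesis using combination[OF \<alpha>] by (simp add: q_def)
  next
    case False
    then have pos: "0 < (\<Sum>j\<in>J. (r j)\<^sup>2)"
      by (auto simp: h_def r_def order.strict_iff_order sum_nonneg)
    have le: "(\<Sum>j\<in>J. r j * p i j) \<le> (\<Sum>j\<in>J. r j * q \<alpha> j)" if i: "i \<in> I" for i
    proof (rule ccontr)
      define v where "v = (\<lambda>j. p i j - q \<alpha> j)"
      define s where "s = (\<Sum>j\<in>J. r j * v j)"
      define V where "V = (\<Sum>j\<in>J. (v j)\<^sup>2)"
      assume "\<not> ?thesis"
      then have s: "0 < s" by (simp add: s_def v_def sum_subtractf right_diff_distrib)
      have V: "0 \<le> V" by (simp add: V_def sum_nonneg)
      \<comment> \<open>Moving from \<open>\<alpha>\<close> towards the vertex \<open>i\<close> by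
        \<open>t\<close> changes \<open>h\<close> by \<open>- 2 * t * s + t\<^sup>2 * V\<close>.
        This step length stays at most 1, is defined also for \<open>V = 0\<close>, and has
        \<open>t * V \<le> s\<close>, so \<open>h\<close> would drop below its minimum.\<close>
      define t where "t = s / (s + V)"
      have t: "0 < t" "t \<le> 1" using s V by (auto simp: t_def field_simps)
      define \<beta> where "\<beta> = (\<lambda>k. (1 - t) * \<alpha> k + t * of_bool (k = i))"
      have "\<beta> \<in> distributions I"
        using \<alpha> t i assms(1)
        by (auto simp: distributions_def \<beta>_def sum.distrib sum_distrib_left[symmetric] of_bool_def)
      then have "h \<alpha> \<le> h \<beta>" by (rule min)
      have "(\<Sum>k\<in>I. \<beta> k * p k j) = (1 - t) * (\<Sum>k\<in>I. \<alpha> k * p k j) + t * p i j" for j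
      proof -
        have "(\<Sum>k\<in>I. \<beta> k * p k j) = (\<Sum>k\<in>I. (1 - t) * (\<alpha> k * p k j) + (if k = i then t * p i j else 0))"
          by (intro sum.cong) (auto simp: \<beta>_def algebra_simps)
        then show ?thesis using i assms(1) by (simp add: sum.distrib sum_distrib_left)
      qed
      then have "q \<beta> j = q \<alpha> j + t * v j" for j
        by (simp add: q_def v_def algebra_simps)
      then have "h \<beta> = (\<Sum>j\<in>J. (r j)\<^sup>2 - 2 * t * (r j * v j) + t\<^sup>2 * (v j)\<^sup>2)"
        unfolding h_def r_def by (intro sum.cong) (simp_all add: power2_eq_square algebra_simps)
      also have "\<dots> = h \<alpha> - 2 * t * s + t\<^sup>2 * V"
        by (simp add: h_def r_def s_def V_def sum.distrib sum_subtractf sum_distrib_left)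
      finally have "t * (2 * s) \<le> t * (t * V)"
        using \<open>h \<alpha> \<le> h \<beta>\<close> by (simp add: power2_eq_square algebra_simps)
      then have "2 * s \<le> t * V" using t by simp
      moreover have "t * V \<le> s" using s V by (simp add: t_def field_simps)
      ultimately show False using s by simp
    qed
    \<comment> \<open>Since \<open>w = q \<alpha> + r\<close>, the functional \<open>r\<close>
      exceeds its bound on the hull by the squared length of \<open>r\<close>.\<close>
    have "(\<Sum>j\<in>J. r j * w j) = (\<Sum>j\<in>J. r j * q \<alpha> j) + (\<Sum>j\<in>J. (r j)\<^sup>2)"
      unfolding sum.distrib[symmetric]
      by (intro sum.cong) (simp_all add: r_def power2_eq_square algebra_simps)
    then show thesis using separated[of "\<Sum>j\<in>J. r j * q \<alpha> j" r] le pos by simp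
  qed
qed

section \<open>The space of channels\<close>

lemma DMC_dist_bound:
  assumes "finite A" "a \<in> A"
  shows "(\<Sum>b\<in>B. \<bar>W' a b - W a b\<bar>) \<le> 2 * DMC_dist A B W W'"
  using assms by (simp add: DMC_dist_def)

lemma DMC_dist_leI:
  assumes "finite A" "A \<noteq> {}" "\<And>a. a \<in> A \<Longrightarrow> (\<Sum>b\<in>B. \<bar>W' a b - W a b\<bar>) \<le> 2 * c"
  shows "DMC_dist A B W W' \<le> c"
proof -
  have "Max ((\<lambda>a. \<Sum>b\<in>B. \<bar>W' a b - W a b\<bar>) ` A) \<le> 2 * c"
    using assms by simp
  then show ?thesis by (simp add: DMC_dist_def)
qed

text \<open>Carries compactness and paths from the product topology over to the metric one. A ball
  contains a neighbourhood given by finitely many strict inequalities between functions continuous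
  in the coordinates.\<close>

lemma continuous_map_DMC_topology:
  assumes "finite A" "A \<noteq> {}" "finite B"
  shows "continuous_map (top_of_set (DMC A B)) (DMC_topology A B) id"
proof -
  interpret Metric_space "DMC A B" "DMC_dist A B" using assms by (rule Metric_space_DMC)
  show ?thesis
    unfolding DMC_topology_def continuous_map_to_metric id_apply
  proof (intro ballI allI impI)
    fix W and e :: real
    assume W: "W \<in> topspace (top_of_set (DMC A B))" and e: "0 < e"
    define G where "G = {V. \<forall>a\<in>A. (\<Sum>b\<in>B. \<bar>V a b - W a b\<bar>) < e}"
    have "G = (\<Inter>a\<in>A. {V. (\<Sum>b\<in>B. \<bar>V a b - W a b\<bar>) < e})" by (auto simp: G_def)
    also have "open \<dots>"
      by (intro open_INT \<open>finite A\<close> ballI open_Collect_less continuous_intros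
          continuous_on_product_then_coordinatewise[OF continuous_on_product_coordinates])
    finally have "open G" .
    show "\<exists>U. openin (top_of_set (DMC A B)) U \<and> W \<in> U \<and> (\<forall>V\<in>U. V \<in> mball W e)"
    proof (intro exI conjI ballI)
      show "openin (top_of_set (DMC A B)) (DMC A B \<inter> G)" using \<open>open G\<close> by blast
      show "W \<in> DMC A B \<inter> G" using W e by (simp add: G_def)
      fix V assume V: "V \<in> DMC A B \<inter> G"
      \<comment> \<open>The factor 1/2 in the metric turns the row bound \<open>e\<close> into
        \<open>e / 2\<close>, which restores strictness after passing to the maximum.\<close>
      then have "DMC_dist A B W V \<le> e / 2"
        using assms by (intro DMC_dist_leI) (auto simp: G_def less_imp_le)
      with e W V show "V \<in> mball W e" by simp
    qed
  qed
qed

lemma topspace_DMC_topology: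
  assumes "finite A" "A \<noteq> {}" "finite B"
  shows "topspace (DMC_topology A B) = DMC A B"
  unfolding DMC_topology_def
  using Metric_space.topspace_mtopology[OF Metric_space_DMC[OF assms]] .

lemma compact_space_DMC_topology:
  assumes "finite A" "A \<noteq> {}" "finite B"
  shows "compact_space (DMC_topology A B)"
proof -
  have "compactin (top_of_set (DMC A B)) (DMC A B)"
    using compact_DMC[OF assms(1,3)] by (simp add: compactin_subtopology)
  from image_compactin[OF this continuous_map_DMC_topology[OF assms]]
  show ?thesis using assms by (simp add: compact_space_def topspace_DMC_topology)
qed

lemma DMC_convex:
  assumes "V \<in> DMC A B" "W \<in> DMC A B" "0 \<le> t" "t \<le> 1"
  shows "(\<lambda>a b. (1 - t) * V a b + t * W a b) \<in> DMC A B"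
  using assms unfolding DMC_def by (simp add: sum.distrib flip: sum_distrib_left)

text \<open>Straight segments are paths: they stay in the convex set of channels and are continuous
  coordinate by coordinate.\<close>

lemma path_connected_space_DMC_topology:
  assumes "finite A" "A \<noteq> {}" "finite B"
  shows "path_connected_space (DMC_topology A B)"
  unfolding path_connected_space_def topspace_DMC_topology[OF assms]
proof (intro ballI)
  fix V W assume VW: "V \<in> DMC A B" "W \<in> DMC A B"
  define g where "g = (\<lambda>(t::real) a b. (1 - t) * V a b + t * W a b)"
  have "continuous_on {0..1} g"
    unfolding g_def by (intro continuous_on_coordinatewise_then_product continuous_intros)
  then have "continuous_map (top_of_set {0..1}) (top_of_set (DMC A B)) g"
    using DMC_convex[OF VW] by (auto simp: continuous_map_in_subtopology g_def)
  from continuous_map_compose[OF this continuous_map_DMC_topology[OF assms]]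
  have "pathin (DMC_topology A B) g" by (simp add: pathin_def)
  moreover have "g 0 = V" "g 1 = W" by (simp_all add: g_def)
  ultimately show "\<exists>g. pathin (DMC_topology A B) g \<and> g 0 = V \<and> g 1 = W" by blast
qed

section \<open>Optimal gain\<close>

text \<open>The gain of a single deterministic strategy. The expressions under the supremum in
  \<open>opt_gain\<close> are mixtures of such gains.\<close>

definition strategy_gain ::
    "'b set \<Rightarrow> nat \<Rightarrow> (nat \<times> nat \<Rightarrow> real) \<Rightarrow> ('a \<Rightarrow> 'b \<Rightarrow> real) \<Rightarrow> (nat \<Rightarrow> 'a) \<Rightarrow> ('b \<Rightarrow> nat) \<Rightarrow> real" where
  "strategy_gain Y n l W f g = 1 / real n * (\<Sum>u=1..n. \<Sum>y\<in>Y. W (f u) y * l (u, g y))"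

lemma distributions_nonneg: "p \<in> distributions A \<Longrightarrow> 0 \<le> p a"
  by (cases "a \<in> A") (auto simp: distributions_def)

lemma distributions_le_1:
  assumes "p \<in> distributions A" "finite A"
  shows "p a \<le> 1"
  using member_le_sum[of a A p] assms by (cases "a \<in> A") (auto simp: distributions_def)

lemma DMC_nonneg: "W \<in> DMC A B \<Longrightarrow> 0 \<le> W a b"
  by (cases "a \<in> A \<and> b \<in> B") (auto simp: DMC_def)

lemma strategy_gain_nonneg:
  assumes "W \<in> DMC X Y" "l \<in> distributions ({1..n} \<times> {1..m})"
  shows "0 \<le> strategy_gain Y n l W f g"
  unfolding strategy_gain_def
  by (intro mult_nonneg_nonneg sum_nonneg DMC_nonneg[OF assms(1)] distributions_nonneg[OF assms(2)]) simp

lemma average_le: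
  fixes c :: real
  assumes "n \<ge> 1" "\<And>u. u \<in> {1..n} \<Longrightarrow> h u \<le> c"
  shows "1 / real n * (\<Sum>u=1..n. h u) \<le> c"
  using sum_bounded_above[of "{1..n}" h c] assms by (simp add: field_simps)

text \<open>No payoff value exceeds 1 and each row of \<open>W\<close> has mass 1. This bounds the
  set whose supremum defines \<open>opt_gain\<close>.\<close>

lemma strategy_gain_le_1:
  assumes "W \<in> DMC X Y" "l \<in> distributions ({1..n} \<times> {1..m})" "n \<ge> 1" "f \<in> {1..n} \<rightarrow> X"
  shows "strategy_gain Y n l W f g \<le> 1"
  unfolding strategy_gain_def
proof (rule average_le)
  fix u assume u: "u \<in> {1..n}"
  have "(\<Sum>y\<in>Y. W (f u) y * l (u, g y)) \<le> (\<Sum>y\<in>Y. W (f u) y)"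
    by (intro sum_mono mult_left_le DMC_nonneg[OF assms(1)] distributions_le_1[OF assms(2)]) simp
  also have "\<dots> = 1" using assms(1,4) u by (auto simp: DMC_def Pi_iff)
  finally show "(\<Sum>y\<in>Y. W (f u) y * l (u, g y)) \<le> 1" .
qed (fact assms)

lemma mixture_gain:
  fixes n k :: nat
  shows "1 / real n * (\<Sum>u=1..n. \<Sum>i=1..k. \<alpha> i * (\<Sum>y\<in>Y. W (f i u) y * l (u, g i y)))
    = (\<Sum>i=1..k. \<alpha> i * strategy_gain Y n l W (f i) (g i))"
  unfolding strategy_gain_def sum_distrib_left
  by (subst sum.swap) (simp only: mult_ac)

lemma mixture_le:
  assumes "\<alpha> \<in> distributions A" "\<And>i. i \<in> A \<Longrightarrow> h i \<le> c"
  shows "(\<Sum>i\<in>A. \<alpha> i * h i) \<le> c"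
proof -
  have "(\<Sum>i\<in>A. \<alpha> i * h i) \<le> (\<Sum>i\<in>A. \<alpha> i * c)"
    using assms by (intro sum_mono mult_left_mono distributions_nonneg) auto
  also have "\<dots> = c" using assms(1) by (simp add: distributions_def flip: sum_distrib_right)
  finally show ?thesis .
qed

definition mixture_gains ::
    "'a set \<Rightarrow> 'b set \<Rightarrow> nat \<Rightarrow> nat \<Rightarrow> (nat \<times> nat \<Rightarrow> real) \<Rightarrow> ('a \<Rightarrow> 'b \<Rightarrow> real) \<Rightarrow> real set" where
  "mixture_gains X Y n m l W = {\<Sum>i=1..k. \<alpha> i * strategy_gain Y n l W (f i) (g i) |
     (k::nat) \<alpha> f g. k \<ge> 1 \<and> \<alpha> \<in> distributions {1..k} \<and>
       (\<forall>i\<in>{1..k}. f i \<in> {1..n} \<rightarrow> X \<and> g i \<in> Y \<rightarrow> {1..m})}"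

lemma opt_gain_eq_Sup: "opt_gain X Y n m l W = Sup (mixture_gains X Y n m l W)"
  unfolding opt_gain_def mixture_gain mixture_gains_def ..

text \<open>The case \<open>k = 1\<close> with a point mass. Together with
  \<open>mixture_gains_le\<close> it reduces upper bounds on optimal gains to deterministic
  strategies.\<close>

lemma strategy_gain_in_mixture_gains:
  assumes "f \<in> {1..n} \<rightarrow> X" "g \<in> Y \<rightarrow> {1..m}"
  shows "strategy_gain Y n l W f g \<in> mixture_gains X Y n m l W"
  unfolding mixture_gains_def
proof (intro CollectI exI conjI)
  show "(1::nat) \<ge> 1" by simp
  show "(\<lambda>i. of_bool (i = 1)) \<in> distributions {1..1::nat}"
    by (simp add: distributions_def)
  show "strategy_gain Y n l W f g
      = (\<Sum>i=1..1::nat. of_bool (i = 1) * strategy_gain Y n l W ((\<lambda>_. f) i) ((\<lambda>_. g) i))"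
    by simp
  show "\<forall>i\<in>{1..1::nat}. (\<lambda>_. f) i \<in> {1..n} \<rightarrow> X \<and> (\<lambda>_. g) i \<in> Y \<rightarrow> {1..m}"
    using assms by blast
qed

lemma mixture_gains_le:
  assumes "\<And>f g. f \<in> {1..n} \<rightarrow> X \<Longrightarrow> g \<in> Y \<rightarrow> {1..m} \<Longrightarrow> strategy_gain Y n l W f g \<le> c"
    and "x \<in> mixture_gains X Y n m l W"
  shows "x \<le> c"
proof -
  obtain k :: nat and \<alpha> f g where
    x: "x = (\<Sum>i=1..k. \<alpha> i * strategy_gain Y n l W (f i) (g i))"
    and "\<alpha> \<in> distributions {1..k}"
    and "\<forall>i\<in>{1..k}. f i \<in> {1..n} \<rightarrow> X \<and> g i \<in> Y \<rightarrow> {1..m}"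
    using assms(2) unfolding mixture_gains_def mem_Collect_eq by (elim exE conjE) (rule that)
  then show ?thesis unfolding x by (intro mixture_le assms(1)) simp_all
qed

lemma strategy_gain_le_opt_gain:
  assumes "W \<in> DMC X Y" "l \<in> distributions ({1..n} \<times> {1..m})" "n \<ge> 1"
    and "f \<in> {1..n} \<rightarrow> X" "g \<in> Y \<rightarrow> {1..m}"
  shows "strategy_gain Y n l W f g \<le> opt_gain X Y n m l W"
  unfolding opt_gain_eq_Sup
proof (rule cSup_upper)
  show "bdd_above (mixture_gains X Y n m l W)"
    by (rule bdd_aboveI[of _ 1], erule mixture_gains_le[rotated], rule strategy_gain_le_1[OF assms(1-3)])
qed (rule strategy_gain_in_mixture_gains[OF assms(4,5)])

text \<open>The assumptions on \<open>X\<close> and \<open>m\<close> supply a constant strategy, so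
  that the supremum is over a nonempty set.\<close>

lemma opt_gain_leI:
  assumes "X \<noteq> {}" "m \<ge> 1"
    and "\<And>f g. f \<in> {1..n} \<rightarrow> X \<Longrightarrow> g \<in> Y \<rightarrow> {1..m} \<Longrightarrow> strategy_gain Y n l W f g \<le> c"
  shows "opt_gain X Y n m l W \<le> c"
  unfolding opt_gain_eq_Sup
proof (rule cSup_least)
  obtain x where "x \<in> X" using assms by blast
  then have "(\<lambda>_. x) \<in> {1..n} \<rightarrow> X" "(\<lambda>_. 1) \<in> Y \<rightarrow> {1..m}" using assms by auto
  then show "mixture_gains X Y n m l W \<noteq> {}" using strategy_gain_in_mixture_gains by fast
qed (rule mixture_gains_le[OF assms(3)])

lemma opt_gain_nonneg:
  assumes "W \<in> DMC X Y" "X \<noteq> {}" "l \<in> distributions ({1..n} \<times> {1..m})" "n \<ge> 1" "m \<ge> 1"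
  shows "0 \<le> opt_gain X Y n m l W"
proof -
  obtain x where "x \<in> X" using assms by blast
  have "0 \<le> strategy_gain Y n l W (\<lambda>_. x) (\<lambda>_. 1)"
    using assms by (intro strategy_gain_nonneg)
  also have "\<dots> \<le> opt_gain X Y n m l W"
    using assms \<open>x \<in> X\<close> by (intro strategy_gain_le_opt_gain) auto
  finally show ?thesis .
qed

lemma opt_gain_le_1:
  assumes "W \<in> DMC X Y" "X \<noteq> {}" "l \<in> distributions ({1..n} \<times> {1..m})" "n \<ge> 1" "m \<ge> 1"
  shows "opt_gain X Y n m l W \<le> 1"
  using strategy_gain_le_1[OF assms(1,3,4)] assms by (intro opt_gain_leI)

text \<open>The same strategy is played on both channels. As payoffs lie between 0 and 1, each input
  loses at most the absolute row difference, that is twice the distance, and averaging keeps this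
  bound. The constant does not depend on \<open>n\<close>, \<open>m\<close> or
  \<open>l\<close>.\<close>

lemma opt_gain_Lipschitz_upper:
  assumes "finite X" "X \<noteq> {}" "V \<in> DMC X Y" "W \<in> DMC X Y"
    and "l \<in> distributions ({1..n} \<times> {1..m})" "n \<ge> 1" "m \<ge> 1"
  shows "opt_gain X Y n m l V \<le> opt_gain X Y n m l W + 2 * DMC_dist X Y W V"
proof (rule opt_gain_leI)
  fix f g assume f: "f \<in> {1..n} \<rightarrow> X" and g: "g \<in> Y \<rightarrow> {1..m}"
  have "strategy_gain Y n l V f g - strategy_gain Y n l W f g
      = 1 / real n * (\<Sum>u=1..n. \<Sum>y\<in>Y. (V (f u) y - W (f u) y) * l (u, g y))"
    by (simp add: strategy_gain_def left_diff_distrib sum_subtractf right_diff_distrib)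
  also have "\<dots> \<le> 2 * DMC_dist X Y W V"
  proof (rule average_le)
    fix u assume u: "u \<in> {1..n}"
    have "(\<Sum>y\<in>Y. (V (f u) y - W (f u) y) * l (u, g y)) \<le> (\<Sum>y\<in>Y. \<bar>V (f u) y - W (f u) y\<bar>)"
    proof (rule sum_mono)
      fix y
      have l: "0 \<le> l (u, g y)" "l (u, g y) \<le> 1"
        using assms(5) by (auto intro: distributions_nonneg distributions_le_1)
      have "(V (f u) y - W (f u) y) * l (u, g y) \<le> \<bar>V (f u) y - W (f u) y\<bar> * l (u, g y)"
        using l by (intro mult_right_mono) auto
      also have "\<dots> \<le> \<bar>V (f u) y - W (f u) y\<bar>" using l by (intro mult_left_le) auto
      finally show "(V (f u) y - W (f u) y) * l (u, g y) \<le> \<bar>V (f u) y - W (f u) y\<bar>" .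
    qed
    also have "\<dots> \<le> 2 * DMC_dist X Y W V"
      using f u assms(1) by (intro DMC_dist_bound) auto
    finally show "(\<Sum>y\<in>Y. (V (f u) y - W (f u) y) * l (u, g y)) \<le> 2 * DMC_dist X Y W V" .
  qed (fact assms)
  finally show "strategy_gain Y n l V f g \<le> opt_gain X Y n m l W + 2 * DMC_dist X Y W V"
    using strategy_gain_le_opt_gain[OF assms(4,5,6) f g] by linarith
qed (use assms in auto)

lemma opt_gain_Lipschitz:
  assumes "finite X" "X \<noteq> {}" "finite Y" "V \<in> DMC X Y" "W \<in> DMC X Y"
    and "l \<in> distributions ({1..n} \<times> {1..m})" "n \<ge> 1" "m \<ge> 1"
  shows "\<bar>opt_gain X Y n m l V - opt_gain X Y n m l W\<bar> \<le> 2 * DMC_dist X Y V W"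
proof -
  have "DMC_dist X Y W V = DMC_dist X Y V W"
    using Metric_space.commute[OF Metric_space_DMC] assms(1-3) .
  then show ?thesis
    using opt_gain_Lipschitz_upper[of X V Y W l n m] opt_gain_Lipschitz_upper[of X W Y V l n m] assms
    by (simp add: abs_le_iff)
qed

section \<open>Shannon containment and optimal gain\<close>

lemma finite_argmax:
  fixes h :: "'a \<Rightarrow> real"
  assumes "finite A" "A \<noteq> {}"
  shows "\<exists>a\<in>A. \<forall>b\<in>A. h b \<le> h a"
proof -
  have "Max (h ` A) \<in> h ` A" using assms by (intro Max_in) auto
  then obtain a where "a \<in> A" "h a = Max (h ` A)" by fastforce
  then show ?thesis using assms by (auto intro!: bexI[of _ a])
qed

lemma DMC_row: "W \<in> DMC A B \<Longrightarrow> a \<in> A \<Longrightarrow> W a \<in> distributions B"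
  by (auto simp: DMC_def distributions_def)

text \<open>The gain is linear in \<open>T\<close> and in \<open>R\<close> separately, so each of the two may be replaced
  by a deterministic best response, row by row.\<close>

lemma strategy_gain_comp_le:
  assumes fin: "finite X'" "X' \<noteq> {}" "finite Y'"
    and V: "V \<in> DMC X' Y'" and R: "R \<in> DMC X X'" and T: "T \<in> DMC Y' Y"
    and l: "l \<in> distributions ({1..n} \<times> {1..m})" and nm: "n \<ge> 1" "m \<ge> 1"
    and f: "f \<in> {1..n} \<rightarrow> X" and g: "g \<in> Y \<rightarrow> {1..m}"
  shows "strategy_gain Y n l (channel_comp Y' T (channel_comp X' V R)) f g \<le> opt_gain X' Y' n m l V"
proof -
  \<comment> \<open>\<open>A u y'\<close> is the probability of output \<open>y'\<close> when
    \<open>u\<close> is sent, and \<open>K y' j\<close> is the total gain from decoding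
    \<open>y'\<close> as \<open>j\<close>. A decoder sees only \<open>y'\<close>, so
    \<open>K\<close> is summed over \<open>u\<close> before the best \<open>j\<close> is
    chosen.\<close>
  define A where "A = (\<lambda>u y'. \<Sum>x'\<in>X'. V x' y' * R (f u) x')"
  define K where "K = (\<lambda>y' j. \<Sum>u=1..n. A u y' * l (u, j))"
  have "\<forall>y'. \<exists>j\<in>{1..m}. \<forall>i\<in>{1..m}. K y' i \<le> K y' j"
    using nm by (intro allI finite_argmax) auto
  then obtain g' where g': "\<And>y'. g' y' \<in> {1..m}" "\<And>y' i. i \<in> {1..m} \<Longrightarrow> K y' i \<le> K y' (g' y')"
    by metis
  \<comment> \<open>With the decoder \<open>g'\<close> fixed, \<open>L u x'\<close> is the gain from
    sending \<open>x'\<close> for \<open>u\<close>; the best input can now be chosen for each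
    \<open>u\<close> separately.\<close>
  define L where "L = (\<lambda>u x'. \<Sum>y'\<in>Y'. V x' y' * l (u, g' y'))"
  have "\<forall>u. \<exists>x\<in>X'. \<forall>x'\<in>X'. L u x' \<le> L u x"
    using fin by (intro allI finite_argmax) auto
  then obtain f' where f': "\<And>u. f' u \<in> X'" "\<And>u x'. x' \<in> X' \<Longrightarrow> L u x' \<le> L u (f' u)"
    by metis
  \<comment> \<open>The sum over \<open>y'\<close> is moved outermost, so that the row
    \<open>T y'\<close> appears as a distribution averaging the values of
    \<open>K y'\<close>.\<close>
  have "(\<Sum>u=1..n. \<Sum>y\<in>Y. (\<Sum>y'\<in>Y'. T y' y * A u y') * l (u, g y))
      = (\<Sum>u=1..n. \<Sum>y\<in>Y. \<Sum>y'\<in>Y'. T y' y * (A u y' * l (u, g y)))"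
    by (simp add: sum_distrib_right mult.assoc)
  also have "\<dots> = (\<Sum>u=1..n. \<Sum>y'\<in>Y'. \<Sum>y\<in>Y. T y' y * (A u y' * l (u, g y)))"
    by (intro sum.cong refl sum.swap)
  also have "\<dots> = (\<Sum>y'\<in>Y'. \<Sum>u=1..n. \<Sum>y\<in>Y. T y' y * (A u y' * l (u, g y)))"
    by (rule sum.swap)
  also have "\<dots> = (\<Sum>y'\<in>Y'. \<Sum>y\<in>Y. \<Sum>u=1..n. T y' y * (A u y' * l (u, g y)))"
    by (intro sum.cong refl sum.swap)
  also have "\<dots> = (\<Sum>y'\<in>Y'. \<Sum>y\<in>Y. T y' y * K y' (g y))"
    by (simp add: K_def sum_distrib_left)
  also have "\<dots> \<le> (\<Sum>y'\<in>Y'. K y' (g' y'))"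
  proof (rule sum_mono)
    fix y' assume "y' \<in> Y'"
    then show "(\<Sum>y\<in>Y. T y' y * K y' (g y)) \<le> K y' (g' y')"
      using g g'(2) by (intro mixture_le DMC_row[OF T]) (auto simp: Pi_iff)
  qed
  also have "\<dots> = (\<Sum>u=1..n. \<Sum>y'\<in>Y'. A u y' * l (u, g' y'))"
    unfolding K_def by (rule sum.swap)
  also have "\<dots> = (\<Sum>u=1..n. \<Sum>y'\<in>Y'. \<Sum>x'\<in>X'. R (f u) x' * (V x' y' * l (u, g' y')))"
    unfolding A_def sum_distrib_right by (simp only: mult_ac)
  also have "\<dots> = (\<Sum>u=1..n. \<Sum>x'\<in>X'. \<Sum>y'\<in>Y'. R (f u) x' * (V x' y' * l (u, g' y')))"
    by (intro sum.cong refl sum.swap)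
  also have "\<dots> = (\<Sum>u=1..n. \<Sum>x'\<in>X'. R (f u) x' * L u x')"
    by (simp add: L_def sum_distrib_left)
  also have "\<dots> \<le> (\<Sum>u=1..n. L u (f' u))"
    using f f'(2) by (intro sum_mono mixture_le DMC_row[OF R]) (auto simp: Pi_iff)
  finally have "strategy_gain Y n l (channel_comp Y' T (channel_comp X' V R)) f g
      \<le> strategy_gain Y' n l V f' g'"
    unfolding strategy_gain_def channel_comp_def L_def A_def by (intro mult_left_mono) auto
  also have "\<dots> \<le> opt_gain X' Y' n m l V"
    using f' g' by (intro strategy_gain_le_opt_gain[OF V l nm(1)]) auto
  finally show ?thesis .
qed

text \<open>The gain is linear in the channel, so \<open>W\<close> gains a mixture of the gains of
  the composites \<open>C i\<close>, each bounded by \<open>strategy_gain_comp_le\<close>.\<close>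

lemma opt_gain_mono:
  assumes fin: "finite X'" "X' \<noteq> {}" "finite Y'" "X \<noteq> {}"
    and V: "V \<in> DMC X' Y'" and VW: "shannon_contains X' Y' V X Y W"
    and l: "l \<in> distributions ({1..n} \<times> {1..m})" and nm: "n \<ge> 1" "m \<ge> 1"
  shows "opt_gain X Y n m l W \<le> opt_gain X' Y' n m l V"
proof (rule opt_gain_leI)
  fix f g assume fg: "f \<in> {1..n} \<rightarrow> X" "g \<in> Y \<rightarrow> {1..m}"
  obtain k :: nat and \<alpha> R T where \<alpha>: "\<alpha> \<in> distributions {1..k}"
    and RT: "\<And>i. i \<in> {1..k} \<Longrightarrow> R i \<in> DMC X X' \<and> T i \<in> DMC Y' Y"
    and W: "W = (\<lambda>x y. \<Sum>i=1..k. \<alpha> i * channel_comp Y' (T i) (channel_comp X' V (R i)) x y)"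
    using VW unfolding shannon_contains_def by blast
  define C where "C = (\<lambda>i. channel_comp Y' (T i) (channel_comp X' V (R i)))"
  have "strategy_gain Y n l W f g = (\<Sum>i=1..k. \<alpha> i * strategy_gain Y n l (C i) f g)"
  proof -
    have "(\<Sum>u=1..n. \<Sum>y\<in>Y. W (f u) y * l (u, g y))
        = (\<Sum>u=1..n. \<Sum>y\<in>Y. \<Sum>i=1..k. \<alpha> i * (C i (f u) y * l (u, g y)))"
      by (simp add: W C_def sum_distrib_right mult.assoc)
    also have "\<dots> = (\<Sum>u=1..n. \<Sum>i=1..k. \<Sum>y\<in>Y. \<alpha> i * (C i (f u) y * l (u, g y)))"
      by (intro sum.cong refl sum.swap)
    also have "\<dots> = (\<Sum>i=1..k. \<Sum>u=1..n. \<Sum>y\<in>Y. \<alpha> i * (C i (f u) y * l (u, g y)))"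
      by (rule sum.swap)
    finally show ?thesis by (simp add: strategy_gain_def sum_distrib_left mult.left_commute)
  qed
  also have "\<dots> \<le> opt_gain X' Y' n m l V"
    unfolding C_def using RT
    by (intro mixture_le[OF \<alpha>] strategy_gain_comp_le[OF fin(1-3) V _ _ l nm fg]) blast+
  finally show "strategy_gain Y n l W f g \<le> opt_gain X' Y' n m l V" .
qed fact+

section \<open>Deterministic pre- and postprocessing\<close>

text \<open>The condition on \<open>a\<close> makes rows outside \<open>A\<close> vanish, as
  \<open>DMC\<close> demands.\<close>

definition det_channel :: "'a set \<Rightarrow> ('a \<Rightarrow> 'b) \<Rightarrow> 'a \<Rightarrow> 'b \<Rightarrow> real" where
  "det_channel A f = (\<lambda>a b. of_bool (a \<in> A \<and> b = f a))"

lemma det_channel_in_DMC: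
  assumes "f \<in> A \<rightarrow> B" "finite B"
  shows "det_channel A f \<in> DMC A B"
proof -
  have "(\<Sum>b\<in>B. det_channel A f a b) = 1" if "a \<in> A" for a
  proof -
    have "(\<Sum>b\<in>B. det_channel A f a b) = (\<Sum>b\<in>B. if b = f a then 1 else 0)"
      using that by (intro sum.cong) (auto simp: det_channel_def)
    also have "\<dots> = 1" using assms that by (auto simp: sum.delta)
    finally show ?thesis .
  qed
  then show ?thesis using assms(1) by (auto simp: DMC_def det_channel_def)
qed

text \<open>The inner sum collapses to the row of \<open>f x\<close>, and the outer one collects the
  fibre of \<open>g\<close> over \<open>y\<close>. Outside \<open>X\<close> and \<open>Y\<close> the
  composite vanishes, in line with the convention for channels.\<close>

lemma det_channel_comp:
  assumes "finite X'" "f \<in> X \<rightarrow> X'" "g \<in> Y' \<rightarrow> Y"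
  shows "channel_comp Y' (det_channel Y' g) (channel_comp X' V (det_channel X f)) x y
    = (if x \<in> X \<and> y \<in> Y then \<Sum>y'\<in>Y'. of_bool (y = g y') * V (f x) y' else 0)"
proof -
  have inner: "channel_comp X' V (det_channel X f) x y' = (if x \<in> X then V (f x) y' else 0)" for y'
  proof -
    have "channel_comp X' V (det_channel X f) x y'
        = (\<Sum>x'\<in>X'. if x' = f x then (if x \<in> X then V (f x) y' else 0) else 0)"
      unfolding channel_comp_def by (intro sum.cong) (auto simp: det_channel_def)
    then show ?thesis using assms by (auto simp: sum.delta)
  qed
  have "channel_comp Y' (det_channel Y' g) (channel_comp X' V (det_channel X f)) x y
      = (\<Sum>y'\<in>Y'. of_bool (y = g y') * (if x \<in> X then V (f x) y' else 0))"
    unfolding channel_comp_def[of Y'] inner by (intro sum.cong) (auto simp: det_channel_def)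
  also have "\<dots> = (if x \<in> X \<and> y \<in> Y then \<Sum>y'\<in>Y'. of_bool (y = g y') * V (f x) y' else 0)"
    using assms(3) by (auto intro!: sum.neutral)
  finally show ?thesis .
qed

text \<open>Enumerating \<open>I\<close> turns weights on pairs into weights on an initial segment
  of the naturals, the pairs becoming deterministic channels \<open>R i\<close> and
  \<open>T i\<close>. The equation is assumed only on \<open>X\<close> and \<open>Y\<close> because
  both sides vanish elsewhere.\<close>

lemma shannon_containsI_det:
  assumes fin: "finite X'" "finite Y" "finite I" "I \<noteq> {}"
    and W: "W \<in> DMC X Y" and \<alpha>: "\<alpha> \<in> distributions I"
    and I: "\<And>f g. (f, g) \<in> I \<Longrightarrow> f \<in> X \<rightarrow> X' \<and> g \<in> Y' \<rightarrow> Y"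
    and eq: "\<And>x y. x \<in> X \<Longrightarrow> y \<in> Y \<Longrightarrow>
      W x y = (\<Sum>(f, g)\<in>I. \<alpha> (f, g) * (\<Sum>y'\<in>Y'. of_bool (y = g y') * V (f x) y'))"
  shows "shannon_contains X' Y' V X Y W"
proof -
  obtain h where h: "bij_betw h {1..card I} I"
    using ex_bij_betw_nat_finite_1[OF fin(3)] by blast
  have hI: "h i \<in> I" if "i \<in> {1..card I}" for i using h that by (auto dest: bij_betwE)
  define \<beta> where "\<beta> = (\<lambda>i. if i \<in> {1..card I} then \<alpha> (h i) else 0)"
  define R where "R = (\<lambda>i. det_channel X (fst (h i)))"
  define T where "T = (\<lambda>i. det_channel Y' (snd (h i)))"
  have "(\<Sum>i=1..card I. \<beta> i) = (\<Sum>i=1..card I. \<alpha> (h i))" by (simp add: \<beta>_def)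
  also have "\<dots> = 1" using sum.reindex_bij_betw[OF h, of \<alpha>] \<alpha> by (simp add: distributions_def)
  finally have "\<beta> \<in> distributions {1..card I}"
    using distributions_nonneg[OF \<alpha>] by (auto simp: distributions_def \<beta>_def)
  moreover have maps: "fst (h i) \<in> X \<rightarrow> X'" "snd (h i) \<in> Y' \<rightarrow> Y" if "i \<in> {1..card I}" for i
    using I[of "fst (h i)" "snd (h i)"] hI[OF that] by auto
  then have "\<forall>i\<in>{1..card I}. R i \<in> DMC X X' \<and> T i \<in> DMC Y' Y"
    using fin unfolding R_def T_def by (blast intro: det_channel_in_DMC)
  moreover have "W x y = (\<Sum>i=1..card I. \<beta> i * channel_comp Y' (T i) (channel_comp X' V (R i)) x y)" for x y
  proof -
    let ?F = "\<lambda>(f, g). \<alpha> (f, g) * (if x \<in> X \<and> y \<in> Y then \<Sum>y'\<in>Y'. of_bool (y = g y') * V (f x) y' else 0)"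
    have "(\<Sum>i=1..card I. \<beta> i * channel_comp Y' (T i) (channel_comp X' V (R i)) x y)
        = (\<Sum>i=1..card I. ?F (h i))"
      using maps by (intro sum.cong refl)
        (simp add: \<beta>_def R_def T_def det_channel_comp[OF fin(1)] case_prod_beta)
    also have "\<dots> = (\<Sum>i\<in>I. ?F i)" by (rule sum.reindex_bij_betw[OF h])
    also have "\<dots> = W x y"
    proof (cases "x \<in> X \<and> y \<in> Y")
      case True
      then show ?thesis by (simp add: eq)
    next
      case False
      then show ?thesis using W by (auto simp: DMC_def intro!: sum.neutral)
    qed
    finally show ?thesis by simp
  qed
  then have "W = (\<lambda>x y. \<Sum>i=1..card I. \<beta> i * channel_comp Y' (T i) (channel_comp X' V (R i)) x y)"
    by blast
  moreover have "card I \<ge> 1" using fin by (simp add: Suc_leI card_gt_0_iff)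
  ultimately show ?thesis unfolding shannon_contains_def by blast
qed

text \<open>A signed payoff \<open>r\<close> on \<open>X \<times> Y\<close> becomes a distribution after adding a constant and
  rescaling, which changes all gains by one and the same affine map.\<close>

lemma strategy_gain_affine:
  fixes r :: "'a \<times> 'b \<Rightarrow> real" and n m :: nat
  assumes \<phi>: "bij_betw \<phi> {1..n} X" and \<psi>: "bij_betw \<psi> {1..m} Y" and "n \<ge> 1"
    and V: "V \<in> DMC X' Y'" and f: "f \<in> {1..n} \<rightarrow> X'" and g: "g \<in> Y' \<rightarrow> {1..m}"
    and l: "\<And>u j. u \<in> {1..n} \<Longrightarrow> j \<in> {1..m} \<Longrightarrow> l (u, j) = (r (\<phi> u, \<psi> j) + M) / N"
  shows "strategy_gain Y' n l V f g
    = ((\<Sum>x\<in>X. \<Sum>y\<in>Y'. V (f (inv_into {1..n} \<phi> x)) y * r (x, \<psi> (g y))) / n + M) / N"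
proof -
  define G where "G = (\<lambda>x. \<Sum>y\<in>Y'. V (f (inv_into {1..n} \<phi> x)) y * r (x, \<psi> (g y)))"
  have "(\<Sum>y\<in>Y'. V (f u) y * l (u, g y)) = (G (\<phi> u) + M) / N" if u: "u \<in> {1..n}" for u
  proof -
    have inv: "inv_into {1..n} \<phi> (\<phi> u) = u" using \<phi> u by (simp add: bij_betw_inv_into_left)
    have "(\<Sum>y\<in>Y'. V (f u) y * l (u, g y)) = (\<Sum>y\<in>Y'. V (f u) y * ((r (\<phi> u, \<psi> (g y)) + M) / N))"
      using g u by (intro sum.cong refl) (simp add: l Pi_iff)
    also have "\<dots> = (G (\<phi> u) + (\<Sum>y\<in>Y'. V (f u) y) * M) / N"
      unfolding G_def inv
      by (simp add: sum_divide_distrib sum_distrib_right distrib_left add_divide_distrib sum.distrib)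
    \<comment> \<open>The constant \<open>M\<close> is weighted by a full row of \<open>V\<close>,
      so it enters unchanged whatever the strategy.\<close>
    also have "(\<Sum>y\<in>Y'. V (f u) y) = 1" using V f u by (auto simp: DMC_def Pi_iff)
    finally show ?thesis by simp
  qed
  then have "strategy_gain Y' n l V f g = 1 / n * (\<Sum>u=1..n. (G (\<phi> u) + M) / N)"
    by (simp add: strategy_gain_def)
  also have "(\<Sum>u=1..n. (G (\<phi> u) + M) / N) = ((\<Sum>x\<in>X. G x) + n * M) / N"
    using sum.reindex_bij_betw[OF \<phi>, of G] by (simp add: sum.distrib flip: sum_divide_distrib)
  finally show ?thesis using \<open>n \<ge> 1\<close> by (simp add: G_def field_simps)
qed

text \<open>The converse of \<open>opt_gain_mono\<close>, with \<open>W\<close> treated as a vector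
  indexed by \<open>X \<times> Y\<close>. Payoffs of one size suffice, as a separating functional
  has one coefficient per pair.\<close>

lemma shannon_contains_if_opt_gain_le:
  fixes X :: "'a set" and Y :: "'b set" and X' :: "'c set" and Y' :: "'d set"
  assumes fin: "finite X" "X \<noteq> {}" "finite Y" "Y \<noteq> {}" "finite X'" "X' \<noteq> {}" "finite Y'"
    and W: "W \<in> DMC X Y" and V: "V \<in> DMC X' Y'"
    and le: "\<And>l. l \<in> distributions ({1..card X} \<times> {1..card Y}) \<Longrightarrow>
      opt_gain X Y (card X) (card Y) l W \<le> opt_gain X' Y' (card X) (card Y) l V"
  shows "shannon_contains X' Y' V X Y W"
proof -
  \<comment> \<open>Extensional functions keep \<open>I\<close> finite over arbitrary types. The
    vector \<open>p (f, g)\<close> is \<open>V\<close> with inputs relabelled by \<open>f\<close>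
    and outputs by \<open>g\<close>.\<close>
  define I where "I = PiE X (\<lambda>_. X') \<times> PiE Y' (\<lambda>_. Y)"
  define p :: "('a \<Rightarrow> 'c) \<times> ('d \<Rightarrow> 'b) \<Rightarrow> 'a \<times> 'b \<Rightarrow> real"
    where "p = (\<lambda>(f, g) (x, y). \<Sum>y'\<in>Y'. of_bool (y = g y') * V (f x) y')"
  have I: "finite I" "I \<noteq> {}"
    using fin by (auto simp: I_def PiE_eq_empty_iff intro!: finite_PiE)
  \<comment> \<open>Evaluating \<open>r\<close> at \<open>p (f, g)\<close> gives the unnormalised
    gain of the strategy \<open>f\<close>, \<open>g\<close> on \<open>V\<close> under the payoff
    \<open>r\<close>.\<close>
  have pay: "(\<Sum>j\<in>X\<times>Y. r j * p (f, g) j) = (\<Sum>x\<in>X. \<Sum>y'\<in>Y'. V (f x) y' * r (x, g y'))"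
    if g: "g \<in> Y' \<rightarrow> Y" for r f g
  proof -
    have "(\<Sum>j\<in>X\<times>Y. r j * p (f, g) j)
        = (\<Sum>x\<in>X. \<Sum>y\<in>Y. \<Sum>y'\<in>Y'. if y = g y' then V (f x) y' * r (x, g y') else 0)"
      unfolding sum.cartesian_product[symmetric] p_def
      by (simp add: sum.cartesian_product' sum_distrib_left)
         (intro sum.cong refl, auto)
    also have "\<dots> = (\<Sum>x\<in>X. \<Sum>y'\<in>Y'. \<Sum>y\<in>Y. if y = g y' then V (f x) y' * r (x, g y') else 0)"
      by (intro sum.cong refl sum.swap)
    also have "\<dots> = (\<Sum>x\<in>X. \<Sum>y'\<in>Y'. V (f x) y' * r (x, g y'))"
      using g fin by (intro sum.cong refl) (auto simp: sum.delta Pi_iff)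
    finally show ?thesis .
  qed
  have "finite (X \<times> Y)" using fin by simp
  show ?thesis
  proof (rule convex_combination_or_separated[OF I \<open>finite (X \<times> Y)\<close>, where w = "\<lambda>(x, y). W x y" and p = p])
    fix \<alpha>
    assume combination: "\<alpha> \<in> distributions I"
      "\<And>j. j \<in> X \<times> Y \<Longrightarrow> (case j of (x, y) \<Rightarrow> W x y) = (\<Sum>i\<in>I. \<alpha> i * p i j)"
    show ?thesis
    proof (rule shannon_containsI_det[OF fin(5,3) I W combination(1)])
      show "f \<in> X \<rightarrow> X' \<and> g \<in> Y' \<rightarrow> Y" if "(f, g) \<in> I" for f g
        using that by (auto simp: I_def)
      show "W x y = (\<Sum>(f, g)\<in>I. \<alpha> (f, g) * (\<Sum>y'\<in>Y'. of_bool (y = g y') * V (f x) y'))"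
        if "x \<in> X" "y \<in> Y" for x y
        using combination(2)[of "(x, y)"] that by (simp add: p_def case_prod_beta)
    qed
  next
    fix r c
    assume separated: "c < (\<Sum>j\<in>X\<times>Y. r j * (case j of (x, y) \<Rightarrow> W x y))"
      "\<And>i. i \<in> I \<Longrightarrow> (\<Sum>j\<in>X\<times>Y. r j * p i j) \<le> c"
    define n m where "n = card X" and "m = card Y"
    have nm: "n \<ge> 1" "m \<ge> 1" using fin by (simp_all add: n_def m_def Suc_leI card_gt_0_iff)
    obtain \<phi> \<psi> where \<phi>: "bij_betw \<phi> {1..n} X" and \<psi>: "bij_betw \<psi> {1..m} Y"
      using fin by (metis ex_bij_betw_nat_finite_1 n_def m_def)
    \<comment> \<open>The shift by \<open>M\<close> makes every entry of \<open>r\<close> strictly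
      positive; the summand 1 ensures strictness. Hence the total mass \<open>N\<close> below is
      positive and can be divided out.\<close>
    define M where "M = 1 + (\<Sum>j\<in>X\<times>Y. \<bar>r j\<bar>)"
    have pos: "0 < r j + M" if "j \<in> X \<times> Y" for j
      using member_le_sum[of j "X \<times> Y" "\<lambda>j. \<bar>r j\<bar>"] that fin by (simp add: M_def)
    define N where "N = (\<Sum>j\<in>X\<times>Y. r j + M)"
    have N: "0 < N" unfolding N_def using fin by (intro sum_pos pos) auto
    define l where "l = (\<lambda>(u, j). if (u, j) \<in> {1..n} \<times> {1..m} then (r (\<phi> u, \<psi> j) + M) / N else 0)"
    have lv: "l (u, j) = (r (\<phi> u, \<psi> j) + M) / N" if "u \<in> {1..n}" "j \<in> {1..m}" for u j
      using that by (simp add: l_def)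
    have "(\<Sum>q\<in>{1..n}\<times>{1..m}. l q) = (\<Sum>u=1..n. \<Sum>j=1..m. (r (\<phi> u, \<psi> j) + M) / N)"
      unfolding sum.cartesian_product' by (intro sum.cong refl) (simp add: lv)
    also have "\<dots> = (\<Sum>u=1..n. \<Sum>y\<in>Y. (r (\<phi> u, y) + M) / N)"
      by (intro sum.cong refl sum.reindex_bij_betw[OF \<psi>])
    also have "\<dots> = (\<Sum>x\<in>X. \<Sum>y\<in>Y. (r (x, y) + M) / N)"
      by (rule sum.reindex_bij_betw[OF \<phi>])
    also have "\<dots> = N / N"
      unfolding N_def sum.cartesian_product' sum_divide_distrib ..
    finally have "(\<Sum>q\<in>{1..n}\<times>{1..m}. l q) = 1" using N by simp
    moreover have "0 \<le> l q" for q
    proof (cases "q \<in> {1..n} \<times> {1..m}")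
      case True
      then obtain u j where q: "q = (u, j)" "u \<in> {1..n}" "j \<in> {1..m}" by blast
      then have "(\<phi> u, \<psi> j) \<in> X \<times> Y" using \<phi> \<psi> by (auto dest: bij_betwE)
      from pos[OF this] N q show ?thesis by (simp add: lv)
    qed (auto simp: l_def split: prod.splits)
    moreover have "l q = 0" if "q \<notin> {1..n} \<times> {1..m}" for q
      using that by (auto simp: l_def split: prod.splits)
    ultimately have l: "l \<in> distributions ({1..n} \<times> {1..m})"
      unfolding distributions_def by blast
    \<comment> \<open>Sending \<open>\<phi> u\<close> for \<open>u\<close> and decoding an output to
      its own label makes the gain on \<open>W\<close> the affine image of \<open>r\<close>
      evaluated at \<open>W\<close>.\<close>
    define g0 where "g0 = inv_into {1..m} \<psi>"
    have g0: "g0 \<in> Y \<rightarrow> {1..m}" and \<phi>X: "\<phi> \<in> {1..n} \<rightarrow> X"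
      using bij_betw_inv_into[OF \<psi>] \<phi> unfolding g0_def by (auto dest: bij_betwE)
    have "opt_gain X' Y' n m l V \<le> (c / n + M) / N"
    proof (rule opt_gain_leI)
      fix f g assume f: "f \<in> {1..n} \<rightarrow> X'" and g: "g \<in> Y' \<rightarrow> {1..m}"
      \<comment> \<open>Transported along \<open>\<phi>\<close> and \<open>\<psi>\<close> and made
        extensional, the strategy becomes a member of \<open>I\<close>, where the bound
        \<open>c\<close> applies.\<close>
      define f1 where "f1 = restrict (\<lambda>x. f (inv_into {1..n} \<phi> x)) X"
      define g1 where "g1 = restrict (\<lambda>y. \<psi> (g y)) Y'"
      have "f1 \<in> PiE X (\<lambda>_. X')"
        using f bij_betw_inv_into[OF \<phi>] unfolding f1_def by (auto dest: bij_betwE)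
      moreover have g1: "g1 \<in> PiE Y' (\<lambda>_. Y)"
        using g \<psi> unfolding g1_def by (auto dest!: bij_betwE)
      ultimately have "(\<Sum>j\<in>X\<times>Y. r j * p (f1, g1) j) \<le> c"
        by (intro separated(2)) (simp add: I_def)
      also have "(\<Sum>j\<in>X\<times>Y. r j * p (f1, g1) j)
          = (\<Sum>x\<in>X. \<Sum>y\<in>Y'. V (f (inv_into {1..n} \<phi> x)) y * r (x, \<psi> (g y)))"
        using g1 by (subst pay) (auto simp: f1_def g1_def)
      finally have "((\<Sum>x\<in>X. \<Sum>y\<in>Y'. V (f (inv_into {1..n} \<phi> x)) y * r (x, \<psi> (g y))) / n + M) / N
          \<le> (c / n + M) / N"
        using N by (intro divide_right_mono add_right_mono) auto
      then show "strategy_gain Y' n l V f g \<le> (c / n + M) / N"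
        by (subst strategy_gain_affine[where r = r and M = M and N = N, OF \<phi> \<psi> nm(1) V f g]) (rule lv)
    qed (use fin nm in auto)
    also have "\<dots> < ((\<Sum>j\<in>X\<times>Y. r j * (case j of (x, y) \<Rightarrow> W x y)) / n + M) / N"
      using separated(1) N nm by (intro divide_strict_right_mono add_strict_right_mono) auto
    also have "\<dots> = strategy_gain Y n l W \<phi> g0"
    proof -
      have "(\<Sum>j\<in>X\<times>Y. r j * (case j of (x, y) \<Rightarrow> W x y))
          = (\<Sum>x\<in>X. \<Sum>y\<in>Y. W (\<phi> (inv_into {1..n} \<phi> x)) y * r (x, \<psi> (g0 y)))"
        unfolding sum.cartesian_product' g0_def
        using \<phi> \<psi> by (intro sum.cong refl) (simp add: bij_betw_inv_into_right)
      then show ?thesis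
        by (subst strategy_gain_affine[where r = r and M = M and N = N, OF \<phi> \<psi> nm(1) W \<phi>X g0])
           (simp_all only: lv)
    qed
    also have "\<dots> \<le> opt_gain X Y n m l W"
      by (rule strategy_gain_le_opt_gain[OF W l nm(1) \<phi>X g0])
    finally show ?thesis using le[of l] l by (simp add: n_def m_def)
  qed
qed

section \<open>The BRM metric\<close>

text \<open>Combines \<open>opt_gain_mono\<close> with its converse, each used in both directions.
  Reflexivity and transitivity of the equivalence then follow from those of equality of gains,
  without composing channels.\<close>

lemma shannon_equiv_iff:
  assumes "finite X" "X \<noteq> {}" "finite Y" "Y \<noteq> {}"
  shows "(W, V) \<in> shannon_equiv X Y \<longleftrightarrow> W \<in> DMC X Y \<and> V \<in> DMC X Y \<and>
    (\<forall>n m l. n \<ge> 1 \<and> m \<ge> 1 \<and> l \<in> distributions ({1..n} \<times> {1..m}) \<longrightarrow>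
      opt_gain X Y n m l W = opt_gain X Y n m l V)" (is "?L \<longleftrightarrow> ?W \<and> ?V \<and> ?G")
proof
  assume L: ?L
  then have "?W" "?V" and "shannon_contains X Y W X Y V" "shannon_contains X Y V X Y W"
    by (simp_all add: shannon_equiv_def)
  then show "?W \<and> ?V \<and> ?G"
    using opt_gain_mono[OF assms(1-3,2)] by (blast intro: antisym)
next
  assume R: "?W \<and> ?V \<and> ?G"
  have "card X \<ge> 1" "card Y \<ge> 1" using assms by (simp_all add: Suc_leI card_gt_0_iff)
  with R have "opt_gain X Y (card X) (card Y) l W = opt_gain X Y (card X) (card Y) l V"
    if "l \<in> distributions ({1..card X} \<times> {1..card Y})" for l using that by blast
  then show ?L
    using R shannon_contains_if_opt_gain_le[OF assms assms(1-3)] by (simp add: shannon_equiv_def)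
qed

lemma equiv_shannon_equiv:
  assumes "finite X" "X \<noteq> {}" "finite Y" "Y \<noteq> {}"
  shows "equiv (DMC X Y) (shannon_equiv X Y)"
proof (rule equivI)
  show "shannon_equiv X Y \<subseteq> DMC X Y \<times> DMC X Y" by (auto simp: shannon_equiv_def)
  show "refl_on (DMC X Y) (shannon_equiv X Y)"
    using assms by (auto simp: refl_on_def shannon_equiv_iff)
  show "sym (shannon_equiv X Y)" by (auto simp: sym_def shannon_equiv_def)
  show "trans (shannon_equiv X Y)"
    by (rule transI) (auto simp: shannon_equiv_iff[OF assms])
qed

text \<open>All members of a class share their optimal gains, so \<open>the_elem\<close> is applied
  to a singleton.\<close>

lemma opt_gain_s_shannon_class:
  assumes "finite X" "X \<noteq> {}" "finite Y" "Y \<noteq> {}" and W: "W \<in> DMC X Y"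
    and "l \<in> distributions ({1..n} \<times> {1..m})" "n \<ge> 1" "m \<ge> 1"
  shows "opt_gain_s X Y n m l (shannon_class X Y W) = opt_gain X Y n m l W"
proof -
  have "W \<in> shannon_class X Y W"
    using assms by (simp add: shannon_class_def shannon_equiv_iff)
  moreover have "opt_gain X Y n m l V = opt_gain X Y n m l W" if "V \<in> shannon_class X Y W" for V
    using that assms by (simp add: shannon_class_def shannon_equiv_iff)
  ultimately have "opt_gain X Y n m l ` shannon_class X Y W = {opt_gain X Y n m l W}"
    by (intro equalityI image_subsetI singletonI subsetI) (metis insertCI, metis imageI singletonD)
  then show ?thesis by (simp add: opt_gain_s_def)
qed

lemma DMC_s_eq_image: "DMC_s X Y = shannon_class X Y ` DMC X Y"
  by (auto simp: DMC_s_def shannon_class_def quotient_def)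

text \<open>The set under the supremum in \<open>BRM_dist\<close>, expressed through representatives
  instead of classes.\<close>

definition gain_gaps ::
    "'a set \<Rightarrow> 'b set \<Rightarrow> ('a \<Rightarrow> 'b \<Rightarrow> real) \<Rightarrow> ('a \<Rightarrow> 'b \<Rightarrow> real) \<Rightarrow> real set" where
  "gain_gaps X Y V W = {\<bar>opt_gain X Y n m l V - opt_gain X Y n m l W\<bar> | n m l.
     n \<ge> 1 \<and> m \<ge> 1 \<and> l \<in> distributions ({1..n} \<times> {1..m})}"

lemma BRM_dist_shannon_class:
  assumes "finite X" "X \<noteq> {}" "finite Y" "Y \<noteq> {}" and VW: "V \<in> DMC X Y" "W \<in> DMC X Y"
  shows "BRM_dist X Y (shannon_class X Y V) (shannon_class X Y W) = Sup (gain_gaps X Y V W)"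
proof -
  have "{\<bar>opt_gain_s X Y n m l (shannon_class X Y V) - opt_gain_s X Y n m l (shannon_class X Y W)\<bar> | n m l.
      n \<ge> 1 \<and> m \<ge> 1 \<and> l \<in> distributions ({1..n} \<times> {1..m})} = gain_gaps X Y V W"
    unfolding gain_gaps_def
    by (intro Collect_cong ex_cong1 rev_conj_cong refl, elim conjE)
       (simp add: opt_gain_s_shannon_class[OF assms(1-4)] VW del: One_nat_def)
  then show ?thesis using VW by (simp add: BRM_dist_def DMC_s_eq_image)
qed

lemma gain_gaps_nonempty: "gain_gaps X Y V W \<noteq> {}"
proof -
  \<comment> \<open>The smallest admissible payoff: one message, one decision, all mass on the
    single pair.\<close>
  have "(\<lambda>p. of_bool (p = (1, 1))) \<in> distributions ({1..1::nat} \<times> {1..1::nat})"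
    by (simp add: distributions_def)
  then have "\<bar>opt_gain X Y 1 1 (\<lambda>p. of_bool (p = (1, 1))) V
      - opt_gain X Y 1 1 (\<lambda>p. of_bool (p = (1, 1))) W\<bar> \<in> gain_gaps X Y V W"
    unfolding gain_gaps_def by blast
  then show ?thesis by blast
qed

text \<open>Both optimal gains lie between 0 and 1. The upper bound justifies taking the supremum in
  the reals.\<close>

lemma gain_gaps_bound:
  assumes "X \<noteq> {}" "V \<in> DMC X Y" "W \<in> DMC X Y" "d \<in> gain_gaps X Y V W"
  shows "0 \<le> d" "d \<le> 1"
proof -
  obtain n m l where d: "d = \<bar>opt_gain X Y n m l V - opt_gain X Y n m l W\<bar>"
    and nml: "n \<ge> 1" "m \<ge> 1" "l \<in> distributions ({1..n} \<times> {1..m})"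
    using assms(4) unfolding gain_gaps_def by blast
  show "0 \<le> d" by (simp add: d)
  show "d \<le> 1"
    using opt_gain_nonneg[OF assms(2,1) nml(3,1,2)] opt_gain_le_1[OF assms(2,1) nml(3,1,2)]
      opt_gain_nonneg[OF assms(3,1) nml(3,1,2)] opt_gain_le_1[OF assms(3,1) nml(3,1,2)]
    by (simp add: d)
qed

lemma gain_gap_le_Sup:
  assumes "X \<noteq> {}" "V \<in> DMC X Y" "W \<in> DMC X Y"
    and "n \<ge> 1" "m \<ge> 1" "l \<in> distributions ({1..n} \<times> {1..m})"
  shows "\<bar>opt_gain X Y n m l V - opt_gain X Y n m l W\<bar> \<le> Sup (gain_gaps X Y V W)"
proof (rule cSup_upper)
  show "\<bar>opt_gain X Y n m l V - opt_gain X Y n m l W\<bar> \<in> gain_gaps X Y V W"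
    using assms(4-6) unfolding gain_gaps_def by blast
  show "bdd_above (gain_gaps X Y V W)"
    using gain_gaps_bound(2)[OF assms(1-3)] by (rule bdd_aboveI)
qed

lemma Sup_gain_gaps_leI:
  assumes "\<And>n m l. n \<ge> 1 \<Longrightarrow> m \<ge> 1 \<Longrightarrow> l \<in> distributions ({1..n} \<times> {1..m}) \<Longrightarrow>
    \<bar>opt_gain X Y n m l V - opt_gain X Y n m l W\<bar> \<le> c"
  shows "Sup (gain_gaps X Y V W) \<le> c"
proof (rule cSup_least[OF gain_gaps_nonempty])
  fix d assume "d \<in> gain_gaps X Y V W"
  then show "d \<le> c" unfolding gain_gaps_def mem_Collect_eq using assms by blast
qed

lemma Sup_gain_gaps_nonneg:
  assumes "X \<noteq> {}" "V \<in> DMC X Y" "W \<in> DMC X Y"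
  shows "0 \<le> Sup (gain_gaps X Y V W)"
proof -
  obtain d where d: "d \<in> gain_gaps X Y V W" using gain_gaps_nonempty by blast
  note bound = gain_gaps_bound[OF assms]
  have "bdd_above (gain_gaps X Y V W)" using bound(2) by (rule bdd_aboveI)
  with d have "d \<le> Sup (gain_gaps X Y V W)" by (rule cSup_upper)
  with bound(1)[OF d] show ?thesis by linarith
qed

text \<open>Distance zero means that every gap vanishes, which is equality of classes by
  \<open>shannon_equiv_iff\<close>. The triangle inequality holds payoff by payoff and passes to the
  supremum.\<close>

lemma Metric_space_BRM:
  assumes "finite X" "X \<noteq> {}" "finite Y" "Y \<noteq> {}"
  shows "Metric_space (DMC_s X Y) (BRM_dist X Y)"
proof
  note dist = BRM_dist_shannon_class[OF assms]
  show "0 \<le> BRM_dist X Y C D" for C D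
  proof (cases "C \<in> DMC_s X Y \<and> D \<in> DMC_s X Y")
    case True
    then show ?thesis using assms(2) by (auto simp: DMC_s_eq_image dist intro: Sup_gain_gaps_nonneg)
  next
    case False
    then show ?thesis by (auto simp: BRM_dist_def)
  qed
  show "BRM_dist X Y C D = BRM_dist X Y D C" for C D
    by (simp add: BRM_dist_def abs_minus_commute conj_commute)
  show "BRM_dist X Y C D = 0 \<longleftrightarrow> C = D" if CD': "C \<in> DMC_s X Y" "D \<in> DMC_s X Y" for C D
  proof -
    obtain V W where VW: "V \<in> DMC X Y" "W \<in> DMC X Y"
      and CD: "C = shannon_class X Y V" "D = shannon_class X Y W"
      using CD' by (auto simp: DMC_s_eq_image)
    have "BRM_dist X Y C D = 0 \<longleftrightarrow> Sup (gain_gaps X Y V W) \<le> 0"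
      using Sup_gain_gaps_nonneg[OF assms(2) VW] by (simp add: CD dist VW)
    also have "\<dots> \<longleftrightarrow> (\<forall>n m l. n \<ge> 1 \<and> m \<ge> 1 \<and> l \<in> distributions ({1..n} \<times> {1..m}) \<longrightarrow>
        opt_gain X Y n m l V = opt_gain X Y n m l W)" (is "_ \<longleftrightarrow> ?G")
    proof
      assume "Sup (gain_gaps X Y V W) \<le> 0"
      then show ?G using gain_gap_le_Sup[OF assms(2) VW] by fastforce
    next
      assume ?G
      then show "Sup (gain_gaps X Y V W) \<le> 0" by (intro Sup_gain_gaps_leI) auto
    qed
    also have "\<dots> \<longleftrightarrow> C = D"
      using equiv_class_eq_iff[OF equiv_shannon_equiv[OF assms], of V W] VW
      by (auto simp: CD shannon_class_def shannon_equiv_iff[OF assms])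
    finally show ?thesis .
  qed
  show "BRM_dist X Y C E \<le> BRM_dist X Y C D + BRM_dist X Y D E"
    if CDE: "C \<in> DMC_s X Y" "D \<in> DMC_s X Y" "E \<in> DMC_s X Y" for C D E
  proof -
    obtain U V W where UVW: "U \<in> DMC X Y" "V \<in> DMC X Y" "W \<in> DMC X Y"
      and eq: "C = shannon_class X Y U" "D = shannon_class X Y V" "E = shannon_class X Y W"
      using CDE by (auto simp: DMC_s_eq_image)
    have "Sup (gain_gaps X Y U W) \<le> Sup (gain_gaps X Y U V) + Sup (gain_gaps X Y V W)"
    proof (rule Sup_gain_gaps_leI)
      fix n m :: nat and l assume "n \<ge> 1" "m \<ge> 1" "l \<in> distributions ({1..n} \<times> {1..m})"
      note gap = gain_gap_le_Sup[OF assms(2) _ _ this]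
      show "\<bar>opt_gain X Y n m l U - opt_gain X Y n m l W\<bar>
          \<le> Sup (gain_gaps X Y U V) + Sup (gain_gaps X Y V W)"
        using gap[OF UVW(1,2)] gap[OF UVW(2,3)] by linarith
    qed
    then show ?thesis by (simp add: eq dist UVW)
  qed
qed

section \<open>The class map and the quotient topology\<close>

text \<open>The Lipschitz bound is uniform over payoffs, so it survives the supremum and makes the
  class map continuous.\<close>

lemma BRM_dist_le_DMC_dist:
  assumes "finite X" "X \<noteq> {}" "finite Y" "Y \<noteq> {}" and VW: "V \<in> DMC X Y" "W \<in> DMC X Y"
  shows "BRM_dist X Y (shannon_class X Y V) (shannon_class X Y W) \<le> 2 * DMC_dist X Y V W"
  unfolding BRM_dist_shannon_class[OF assms]
  by (intro Sup_gain_gaps_leI opt_gain_Lipschitz assms)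

text \<open>Under a quotient map the open sets of the target are those with open preimage, so
  \<open>T\<close> and \<open>f\<close> determine them.\<close>

lemma quotient_map_unique_topology:
  assumes "quotient_map T S f" "quotient_map T S' f"
  shows "S = S'"
proof (rule topology_eq[THEN iffD2], intro allI)
  fix U
  have "topspace S = topspace S'" using assms by (auto simp: quotient_map_def)
  then show "openin S U \<longleftrightarrow> openin S' U"
    using assms openin_subset[of S U] openin_subset[of S' U] unfolding quotient_map_def by metis
qed

text \<open>The metric axioms are part of the conclusion because \<open>mtopology\<close> has its
  intended meaning only under them.\<close>

theorem theorem3:
  fixes X :: "'a set" and Y :: "'b set"
  assumes "finite X" "X \<noteq> {}" "finite Y" "Y \<noteq> {}"
  shows "Metric_space (DMC_s X Y) (BRM_dist X Y)
    \<and> Metric_space.mtopology (DMC_s X Y) (BRM_dist X Y) = DMC_s_topology X Y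
    \<and> compact_space (Metric_space.mtopology (DMC_s X Y) (BRM_dist X Y))
    \<and> path_connected_space (Metric_space.mtopology (DMC_s X Y) (BRM_dist X Y))"
proof -
  interpret D: Metric_space "DMC X Y" "DMC_dist X Y" using assms(1-3) by (rule Metric_space_DMC)
  interpret B: Metric_space "DMC_s X Y" "BRM_dist X Y" using assms by (rule Metric_space_BRM)
  have cont: "continuous_map (DMC_topology X Y) B.mtopology (shannon_class X Y)"
    unfolding B.continuous_map_to_metric topspace_DMC_topology[OF assms(1-3)]
  proof (intro ballI allI impI)
    fix W and e :: real assume W: "W \<in> DMC X Y" and e: "0 < e"
    show "\<exists>U. openin (DMC_topology X Y) U \<and> W \<in> U \<and>
        (\<forall>V\<in>U. shannon_class X Y V \<in> B.mball (shannon_class X Y W) e)"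
    proof (intro exI conjI ballI)
      \<comment> \<open>The radius \<open>e / 2\<close> offsets the Lipschitz constant 2.\<close>
      show "openin (DMC_topology X Y) (D.mball W (e / 2))" unfolding DMC_topology_def by simp
      show "W \<in> D.mball W (e / 2)" using W e by simp
      fix V assume "V \<in> D.mball W (e / 2)"
      then have V: "V \<in> DMC X Y" and "DMC_dist X Y W V < e / 2" by auto
      then have "BRM_dist X Y (shannon_class X Y W) (shannon_class X Y V) < e"
        using BRM_dist_le_DMC_dist[OF assms W V] by linarith
      then show "shannon_class X Y V \<in> B.mball (shannon_class X Y W) e"
        using V W by (simp add: B.in_mball) (simp add: DMC_s_eq_image)
    qed
  qed
  \<comment> \<open>A continuous map from a compact space to a Hausdorff space is closed, and a
    closed continuous surjection is a quotient map.\<close>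
  have quot: "quotient_map (DMC_topology X Y) B.mtopology (shannon_class X Y)"
    by (intro continuous_imp_quotient_map cont compact_space_DMC_topology assms(1-3)
          B.Hausdorff_space_mtopology)
       (simp only: topspace_DMC_topology[OF assms(1-3)] B.topspace_mtopology DMC_s_eq_image[symmetric])
  have "B.mtopology = DMC_s_topology X Y"
    unfolding DMC_s_topology_def
    using quot quotient_map_quotient_topology by (rule quotient_map_unique_topology)
  moreover have "compact_space B.mtopology"
    using image_compactin[OF compact_space_DMC_topology[OF assms(1-3), unfolded compact_space_def] cont]
      quotient_imp_surjective_map[OF quot]
    by (simp add: compact_space_def)
  moreover have "path_connected_space B.mtopology"
    using quot path_connected_space_DMC_topology[OF assms(1-3)]
    by (rule path_connected_space_quotient_map_image)
  ultimately show ?thesis using B.Metric_space_axioms by blast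
qed

end
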